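(* If $G$ is a connected graph with $\Delta(G)\ge 3$, then the subdivision graph $S(G)$ is of AVD-Type 1, i.e. $\chi''_a(S(G))=\Delta(S(G))+1$.
   Context: All graphs are finite, undirected and simple. $\Delta(G)$ is the maximum degree of $G$. A proper total coloring of a graph $G$ is a coloring of $V(G)\cup E(G)$ in which no two adjacent or incident elements receive the same color. An adjacent vertex distinguishing (AVD) total coloring of $G$ is a proper total coloring $f$ such that $C_G(u)\ne C_G(v)$ for every edge $uv\in E(G)$, where $C_G(u)=\{f(u)\}\cup\{f(uw): uw\in E(G)\}$. The AVD-total chromatic number $\chi''_a(G)$ is the least number of colors in an AVD-total coloring of $G$. A graph $G$ is of AVD-Type $i$ ($i\in\{1,2,3\}$) if $\chi''_a(G)=\Delta(G)+i$. The subdivision graph $S(G)$ is obtained from $G$ by replacing each edge $xy\in E(G)$ with the two edges $xw_{xy}$ and $w_{xy}y$, where $w_{xy}$ is a new vertex. *)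

theory Defs
  imports Main
begin

record 'a ugraph =
  verts :: "'a set"
  edges :: "'a set set"

text \<open>An undirected edge joining \<open>u\<close> and \<open>v\<close> is the two-element set \<open>{u, v}\<close>,
  so loops and multiple edges are excluded.\<close>

definition fin_simple_graph :: "'a ugraph \<Rightarrow> bool" where
  "fin_simple_graph G \<longleftrightarrow>
     finite (verts G) \<and> (\<forall>e\<in>edges G. e \<subseteq> verts G \<and> card e = 2)"

text \<open>The graph without vertices does not count as connected.\<close>

definition connected_graph :: "'a ugraph \<Rightarrow> bool" where
  "connected_graph G \<longleftrightarrow>
     verts G \<noteq> {} \<and>
     (\<forall>u\<in>verts G. \<forall>v\<in>verts G. (u, v) \<in> {(x, y). {x, y} \<in> edges G}\<^sup>*)"

definition degree :: "'a ugraph \<Rightarrow> 'a \<Rightarrow> nat" where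
  "degree G v = card {e \<in> edges G. v \<in> e}"

text \<open>Meaningful for finite graphs with at least one vertex.\<close>

definition max_degree :: "'a ugraph \<Rightarrow> nat" where
  "max_degree G = Max (degree G ` verts G)"

text \<open>A total coloring is a single map on the disjoint union of vertices and edges:
  \<open>f (Inl v)\<close> is the color of the vertex \<open>v\<close>, \<open>f (Inr e)\<close> that of the edge \<open>e\<close>.
  Values outside \<open>verts G <+> edges G\<close> are irrelevant.\<close>

definition proper_total_coloring :: "'a ugraph \<Rightarrow> ('a + 'a set \<Rightarrow> 'c) \<Rightarrow> bool" where
  "proper_total_coloring G f \<longleftrightarrow>
     (\<forall>u v. {u, v} \<in> edges G \<longrightarrow> f (Inl u) \<noteq> f (Inl v)) \<and>
     (\<forall>e\<in>edges G. \<forall>e'\<in>edges G. e \<noteq> e' \<and> e \<inter> e' \<noteq> {} \<longrightarrow> f (Inr e) \<noteq> f (Inr e')) \<and>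
     (\<forall>e\<in>edges G. \<forall>v\<in>e. f (Inl v) \<noteq> f (Inr e))"

definition color_set :: "'a ugraph \<Rightarrow> ('a + 'a set \<Rightarrow> 'c) \<Rightarrow> 'a \<Rightarrow> 'c set" where
  "color_set G f u = {f (Inl u)} \<union> {f (Inr {u, w}) | w. {u, w} \<in> edges G}"

definition avd_total_coloring :: "'a ugraph \<Rightarrow> ('a + 'a set \<Rightarrow> 'c) \<Rightarrow> bool" where
  "avd_total_coloring G f \<longleftrightarrow>
     proper_total_coloring G f \<and>
     (\<forall>u v. {u, v} \<in> edges G \<longrightarrow> color_set G f u \<noteq> color_set G f v)"

text \<open>For a finite simple graph the minimum exists, since coloring all elements differently
  is an AVD-total coloring; natural numbers therefore suffice as colors.\<close>

definition avd_total_chromatic_number :: "'a ugraph \<Rightarrow> nat" where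
  "avd_total_chromatic_number G =
     (LEAST k. \<exists>f :: 'a + 'a set \<Rightarrow> nat.
        avd_total_coloring G f \<and> card (f ` (verts G <+> edges G)) = k)"

definition avd_type :: "'a ugraph \<Rightarrow> nat \<Rightarrow> bool" where
  "avd_type G i \<longleftrightarrow>
     i \<in> {1, 2, 3} \<and> avd_total_chromatic_number G = max_degree G + i"

text \<open>The new vertex \<open>w\<^sub>x\<^sub>y\<close> on the edge \<open>{x, y}\<close> is \<open>Inr {x, y}\<close>; an original vertex \<open>x\<close>
  becomes \<open>Inl x\<close>.\<close>

definition subdivision :: "'a ugraph \<Rightarrow> ('a + 'a set) ugraph" where
  "subdivision G =
     \<lparr> verts = verts G <+> edges G,
       edges = {{Inl x, Inr e} | x e. e \<in> edges G \<and> x \<in> e} \<rparr>"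

end

theory Submission
  imports Defs
begin

text \<open>Color all original vertices with one color and the edges of the bipartite graph \<open>S(G)\<close>
  with the \<open>\<Delta>\<close> other colors, by Koenig's edge coloring theorem. A subdivision vertex sees two
  edge colors, and since \<open>\<Delta> \<ge> 3\<close> a third one is free for it. The color of the original vertices
  then occurs in the color set of every original vertex and of no subdivision vertex.\<close>

section \<open>Koenig's edge coloring theorem\<close>

text \<open>A relation encodes a bipartite graph: a pair is an edge from its left to its right end,
  so position alone separates the two sides.\<close>

definition proper_rel_coloring :: "('a \<times> 'b) set \<Rightarrow> nat \<Rightarrow> ('a \<Rightarrow> 'b \<Rightarrow> nat) \<Rightarrow> bool" where
  "proper_rel_coloring H k c \<longleftrightarrow>
     (\<forall>u v. (u, v) \<in> H \<longrightarrow> c u v < k) \<and>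
     (\<forall>u v v'. (u, v) \<in> H \<longrightarrow> (u, v') \<in> H \<longrightarrow> c u v = c u v' \<longrightarrow> v = v') \<and>
     (\<forall>u u' v. (u, v) \<in> H \<longrightarrow> (u', v) \<in> H \<longrightarrow> c u v = c u' v \<longrightarrow> u = u')"

text \<open>Kempe exchange: swapping \<open>a\<close> and \<open>b\<close> along one alternating
  path frees \<open>a\<close> at \<open>y\<close> and keeps it free at \<open>x\<close>. This
  prepares the insertion of the edge \<open>(x, y)\<close>.\<close>

lemma proper_rel_coloring_swap:
  assumes c: "proper_rel_coloring H k c"
    and a: "a < k" and b: "b < k"
    and x: "\<And>v. (x, v) \<in> H \<Longrightarrow> c x v \<noteq> a"
    and y: "\<And>u. (u, y) \<in> H \<Longrightarrow> c u y \<noteq> b"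
  obtains c' where "proper_rel_coloring H k c'"
    and "\<And>v. (x, v) \<in> H \<Longrightarrow> c' x v \<noteq> a" and "\<And>u. (u, y) \<in> H \<Longrightarrow> c' u y \<noteq> a"
proof -
  text \<open>\<open>R\<close> is the right half of the vertex set of the path from \<open>y\<close> with colors alternating between
    \<open>a\<close> and \<open>b\<close>. It enters a left vertex by an edge of color \<open>a\<close>, so it avoids \<open>x\<close>.\<close>
  define R where
    "R = {(v, v'). \<exists>u. (u, v) \<in> H \<and> c u v = a \<and> (u, v') \<in> H \<and> c u v' = b}\<^sup>* `` {y}"
  define s where "s i = (if i = a then b else if i = b then a else i)" for i
  \<comment> \<open>The right end alone decides: an edge of color \<open>a\<close> or
    \<open>b\<close> lies on the path iff its right end is in \<open>R\<close>, and \<open>s\<close>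
    fixes all other colors.\<close>
  define c' where "c' u v = (if v \<in> R then s (c u v) else c u v)" for u v
  have lt: "c u v < k" if "(u, v) \<in> H" for u v
    using c that unfolding proper_rel_coloring_def by blast
  have row: "v = v'" if "(u, v) \<in> H" "(u, v') \<in> H" "c u v = c u v'" for u v v'
    using c that unfolding proper_rel_coloring_def by blast
  have col: "u = u'" if "(u, v) \<in> H" "(u', v) \<in> H" "c u v = c u' v" for u u' v
    using c that unfolding proper_rel_coloring_def by blast
  have yR: "y \<in> R" unfolding R_def by blast
  have forward: "v' \<in> R" if "v \<in> R" "(u, v) \<in> H" "c u v = a" "(u, v') \<in> H" "c u v' = b" for u v v'
    using that unfolding R_def by (auto intro: rtrancl_into_rtrancl)
  \<comment> \<open>Since \<open>b\<close> is missing at \<open>y\<close>, the path reached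
    \<open>v'\<close> by an edge of color \<open>b\<close>. Only one such edge exists at
    \<open>v'\<close>, so its left end is \<open>u\<close>, which the path entered by color
    \<open>a\<close>.\<close>
  have backward: "\<exists>v\<in>R. (u, v) \<in> H \<and> c u v = a" if v': "v' \<in> R" "(u, v') \<in> H" "c u v' = b" for u v'
  proof -
    have "v' \<noteq> y" using that y by blast
    then obtain v u' where v: "v \<in> R" "(u', v) \<in> H" "c u' v = a" "(u', v') \<in> H" "c u' v' = b"
      using v'(1) unfolding R_def by (auto elim: rtranclE)
    then have "u' = u" using col[of u' v' u] v' by simp
    then show ?thesis using v by blast
  qed
  have s_inj: "s i = s j \<longleftrightarrow> i = j" for i j
    unfolding s_def by auto
  \<comment> \<open>A clash at a left vertex between a recolored and an unchanged edge would need
    colors \<open>a\<close> and \<open>b\<close> there. But the path contains both of these edges or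
    neither.\<close>
  have mixed: False if uv: "(u, v) \<in> H" "(u, v') \<in> H" "v \<in> R" "v' \<notin> R" "s (c u v) = c u v'" for u v v'
  proof -
    consider "c u v = a" "c u v' = b" | "c u v = b" "c u v' = a" | "c u v = c u v'"
      using \<open>s (c u v) = c u v'\<close> unfolding s_def by (auto split: if_splits)
    then show False
    proof cases
      case 1
      then show False using forward that by blast
    next
      case 2
      then obtain w where "w \<in> R" "(u, w) \<in> H" "c u w = a"
        using backward uv by blast
      then show False using row[of u w v'] 2 uv by simp
    next
      case 3
      then show False using that row by blast
    qed
  qed
  show thesis
  proof
    show "proper_rel_coloring H k c'"
      unfolding proper_rel_coloring_def
    proof (intro conjI allI impI)
      fix u v assume "(u, v) \<in> H"
      then show "c' u v < k" using lt a b unfolding c'_def s_def by simp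
    next
      fix u v v' assume H: "(u, v) \<in> H" "(u, v') \<in> H" and eq: "c' u v = c' u v'"
      show "v = v'"
      proof (cases "v \<in> R \<longleftrightarrow> v' \<in> R")
        case True
        then show ?thesis using row H eq by (auto simp: c'_def s_inj split: if_splits)
      next
        case False
        then show ?thesis
          using mixed[OF H] mixed[OF H(2,1)] eq unfolding c'_def by auto
      qed
    next
      fix u u' v assume "(u, v) \<in> H" "(u', v) \<in> H" "c' u v = c' u' v"
      then show "u = u'" using col by (auto simp: c'_def s_inj split: if_splits)
    qed
    \<comment> \<open>A new \<open>a\<close> at \<open>x\<close> would come from \<open>b\<close> on
      the path, and then the path would have entered \<open>x\<close> by color
      \<open>a\<close>.\<close>
    show "c' x v \<noteq> a" if "(x, v) \<in> H" for v
    proof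
      assume eq: "c' x v = a"
      then have "v \<in> R" "c x v = b"
        using x[OF that] unfolding c'_def s_def by (auto split: if_splits)
      then show False using backward[of v x] x that by blast
    qed
    show "c' u y \<noteq> a" if "(u, y) \<in> H" for u
      using y that yR unfolding c'_def s_def by auto
  qed
qed

lemma free_color:
  fixes A :: "nat set"
  assumes "finite A" "card A < k"
  obtains a where "a < k" "a \<notin> A"
proof -
  have "\<not> {..<k} \<subseteq> A"
    using assms card_mono[of A "{..<k}"] by auto
  then show thesis using that by blast
qed

text \<open>Induction on the edges. The new edge needs a color free at both of its ends; each end
  has a free color, and the exchange makes one color serve both.\<close>

theorem Konig_edge_coloring:
  assumes "finite H"
    and "\<And>u. card (H `` {u}) \<le> k" and "\<And>v. card (H\<inverse> `` {v}) \<le> k"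
  shows "\<exists>c. proper_rel_coloring H k c"
  using assms
proof (induction H)
  case empty
  show ?case by (simp add: proper_rel_coloring_def)
next
  case (insert p H)
  obtain x y where p: "p = (x, y)" by fastforce
  have fin: "finite (H `` {u})" "finite (H\<inverse> `` {v})" for u v
    using insert.hyps(1) by (auto simp: finite_Image)
  have le: "card (H `` {u}) \<le> k" "card (H\<inverse> `` {v}) \<le> k" for u v
  proof -
    show "card (H `` {u}) \<le> k"
      by (rule order.trans[OF card_mono insert.prems(1)[of u]])
        (use insert.hyps(1) in \<open>auto simp: finite_Image\<close>)
    show "card (H\<inverse> `` {v}) \<le> k"
      by (rule order.trans[OF card_mono insert.prems(2)[of v]])
        (use insert.hyps(1) in \<open>auto simp: finite_Image\<close>)
  qed
  then obtain c where c: "proper_rel_coloring H k c"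
    using insert.IH by blast
  \<comment> \<open>The new edge counts towards the degree of both of its ends, so in
    \<open>H\<close> these degrees are strictly below \<open>k\<close>.\<close>
  have "insert p H `` {x} = insert y (H `` {x})" "y \<notin> H `` {x}"
    "(insert p H)\<inverse> `` {y} = insert x (H\<inverse> `` {y})" "x \<notin> H\<inverse> `` {y}"
    using insert.hyps(2) p by auto
  then have less: "card (H `` {x}) < k" "card (H\<inverse> `` {y}) < k"
    using insert.prems(1)[of x] insert.prems(2)[of y] fin by auto
  have "card (c x ` (H `` {x})) < k"
    by (rule le_less_trans[OF card_image_le less(1)]) (rule fin)
  with free_color[of "c x ` (H `` {x})"] fin(1)
  obtain a where a: "a < k" "a \<notin> c x ` (H `` {x})" by blast
  have "card ((\<lambda>u. c u y) ` (H\<inverse> `` {y})) < k"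
    by (rule le_less_trans[OF card_image_le less(2)]) (rule fin)
  with free_color[of "(\<lambda>u. c u y) ` (H\<inverse> `` {y})"] fin(2)
  obtain b where b: "b < k" "b \<notin> (\<lambda>u. c u y) ` (H\<inverse> `` {y})" by blast
  obtain c' where c': "proper_rel_coloring H k c'"
    and free: "\<And>v. (x, v) \<in> H \<Longrightarrow> c' x v \<noteq> a" "\<And>u. (u, y) \<in> H \<Longrightarrow> c' u y \<noteq> a"
  proof (rule proper_rel_coloring_swap[OF c a(1) b(1), of x y])
    show "c x v \<noteq> a" if "(x, v) \<in> H" for v using a(2) that by blast
    show "c u y \<noteq> b" if "(u, y) \<in> H" for u using b(2) that by blast
  qed (rule that)
  define d where "d u v = (if u = x \<and> v = y then a else c' u v)" for u v
  have "proper_rel_coloring (insert p H) k d"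
    unfolding proper_rel_coloring_def p
  proof (intro conjI allI impI)
    fix u v assume "(u, v) \<in> insert (x, y) H"
    then show "d u v < k"
      using c' a(1) unfolding proper_rel_coloring_def d_def by auto
  next
    fix u v v' assume H: "(u, v) \<in> insert (x, y) H" "(u, v') \<in> insert (x, y) H" "d u v = d u v'"
    show "v = v'"
    proof (rule ccontr)
      assume "v \<noteq> v'"
      then show False using H c' free(1)[of v] free(1)[of v']
        unfolding proper_rel_coloring_def d_def by (auto split: if_splits)
    qed
  next
    fix u u' v assume H: "(u, v) \<in> insert (x, y) H" "(u', v) \<in> insert (x, y) H" "d u v = d u' v"
    show "u = u'"
    proof (rule ccontr)
      assume "u \<noteq> u'"
      then show False using H c' free(2)[of u] free(2)[of u']
        unfolding proper_rel_coloring_def d_def by (auto split: if_splits)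
    qed
  qed
  then show ?case by (rule exI[of _ d])
qed

section \<open>Degrees and the lower bound on the number of colors\<close>

lemma finite_edges: "fin_simple_graph G \<Longrightarrow> finite (edges G)"
  unfolding fin_simple_graph_def by (meson Pow_iff finite_Pow_iff finite_subset subsetI)

text \<open>A vertex and its incident edges are pairwise adjacent or incident, so they already use
  one color more than the degree.\<close>

lemma degree_less_card_colors:
  assumes G: "fin_simple_graph G" and f: "proper_total_coloring G f" and v: "v \<in> verts G"
  shows "degree G v < card (f ` (verts G <+> edges G))"
proof -
  let ?E = "{e \<in> edges G. v \<in> e}" and ?C = "f ` (verts G <+> edges G)"
  have finE: "finite ?E" using finite_edges[OF G] by simp
  have inj: "inj_on (\<lambda>e. f (Inr e)) ?E"
    using f unfolding proper_total_coloring_def inj_on_def by blast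
  have new: "f (Inl v) \<notin> (\<lambda>e. f (Inr e)) ` ?E"
    using f unfolding proper_total_coloring_def by blast
  have fin: "finite ?C"
    using G finite_edges[OF G] by (simp add: fin_simple_graph_def)
  have sub: "insert (f (Inl v)) ((\<lambda>e. f (Inr e)) ` ?E) \<subseteq> ?C"
    using v by auto
  have "Suc (degree G v) = card (insert (f (Inl v)) ((\<lambda>e. f (Inr e)) ` ?E))"
    using card_image[OF inj] new finE by (simp add: degree_def)
  then show ?thesis
    using card_mono[OF fin sub] by simp
qed

lemma max_degree_ge:
  "fin_simple_graph G \<Longrightarrow> v \<in> verts G \<Longrightarrow> degree G v \<le> max_degree G"
  by (simp add: fin_simple_graph_def max_degree_def)

lemma max_degree_attained:
  assumes "fin_simple_graph G" "verts G \<noteq> {}"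
  obtains v where "v \<in> verts G" "degree G v = max_degree G"
proof -
  have "Max (degree G ` verts G) \<in> degree G ` verts G"
    using assms by (intro Max_in) (auto simp: fin_simple_graph_def)
  then show thesis using that by (auto simp: max_degree_def)
qed

section \<open>Degrees in the subdivision graph\<close>

lemma fin_simple_graph_subdivision:
  assumes "fin_simple_graph G"
  shows "fin_simple_graph (subdivision G)"
  using assms finite_edges[OF assms] unfolding fin_simple_graph_def subdivision_def by fastforce

lemma degree_subdivision_Inl: "degree (subdivision G) (Inl x) = degree G x"
proof -
  have "{h \<in> edges (subdivision G). Inl x \<in> h} = (\<lambda>e. {Inl x, Inr e}) ` {e \<in> edges G. x \<in> e}"
    unfolding subdivision_def by auto
  moreover have "inj_on (\<lambda>e. {Inl x, Inr e}) {e \<in> edges G. x \<in> e}"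
    by (auto simp: inj_on_def doubleton_eq_iff)
  ultimately show ?thesis by (simp add: degree_def card_image)
qed

lemma degree_subdivision_Inr:
  assumes "fin_simple_graph G" "e \<in> edges G"
  shows "degree (subdivision G) (Inr e) = 2"
proof -
  have "{h \<in> edges (subdivision G). Inr e \<in> h} = (\<lambda>x. {Inl x, Inr e}) ` e"
    using assms(2) unfolding subdivision_def by auto
  moreover have "inj_on (\<lambda>x. {Inl x, Inr e}) e"
    by (auto simp: inj_on_def doubleton_eq_iff)
  ultimately show ?thesis
    using assms by (simp add: degree_def card_image fin_simple_graph_def)
qed

text \<open>Original vertices keep their degrees, and the bound 2 covers the degree of the
  subdivision vertices.\<close>

lemma max_degree_subdivision:
  assumes G: "fin_simple_graph G" "verts G \<noteq> {}" and ge: "max_degree G \<ge> 2"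
  shows "max_degree (subdivision G) = max_degree G"
proof (rule antisym)
  have V: "verts (subdivision G) = verts G <+> edges G"
    by (simp add: subdivision_def)
  then have "verts (subdivision G) \<noteq> {}" using G(2) by auto
  then obtain w where w: "w \<in> verts (subdivision G)"
    "degree (subdivision G) w = max_degree (subdivision G)"
    using max_degree_attained fin_simple_graph_subdivision[OF G(1)] by metis
  have "degree (subdivision G) w \<le> max_degree G"
    using w(1) ge max_degree_ge[OF G(1)] unfolding V
    by (auto simp: degree_subdivision_Inl degree_subdivision_Inr[OF G(1)])
  then show "max_degree (subdivision G) \<le> max_degree G" using w(2) by simp
next
  obtain v where v: "v \<in> verts G" "degree G v = max_degree G"
    using max_degree_attained G by metis
  have "Inl v \<in> verts (subdivision G)" using v(1) by (auto simp: subdivision_def)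
  then have "degree (subdivision G) (Inl v) \<le> max_degree (subdivision G)"
    by (rule max_degree_ge[OF fin_simple_graph_subdivision[OF G(1)]])
  then show "max_degree G \<le> max_degree (subdivision G)"
    using v(2) by (simp add: degree_subdivision_Inl)
qed

section \<open>The coloring of the subdivision graph\<close>

text \<open>The colors below \<open>max_degree G\<close> go to edges and subdivision vertices, and
  \<open>max_degree G\<close> itself to the original vertices. As 0 is a color, this makes
  \<open>max_degree G + 1\<close> colors.\<close>

lemma subdivision_coloring:
  assumes G: "fin_simple_graph G" and ge: "max_degree G \<ge> 3"
  obtains f :: "('a + 'a set) + ('a + 'a set) set \<Rightarrow> nat"
  where "avd_total_coloring (subdivision G) f"
    and "f ` (verts (subdivision G) <+> edges (subdivision G)) \<subseteq> {..max_degree G}"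
proof -
  let ?D = "max_degree G" and ?S = "subdivision G"
  \<comment> \<open>The incidence relation of \<open>G\<close> is the edge set of its subdivision,
    with original vertices on the left and subdivision vertices on the right.\<close>
  define H where "H = {(x, e). e \<in> edges G \<and> x \<in> e}"
  have edge: "e \<subseteq> verts G" "card e = 2" "finite e" if "e \<in> edges G" for e
    using G that unfolding fin_simple_graph_def by (auto intro: finite_subset)
  have ES: "edges ?S = {{Inl x, Inr e} | x e. (x, e) \<in> H}"
    unfolding subdivision_def H_def by auto
  have "H \<subseteq> verts G \<times> edges G" using edge unfolding H_def by auto
  then have finH: "finite H"
    using G finite_edges[OF G] unfolding fin_simple_graph_def
    by (meson finite_SigmaI finite_subset)
  have row: "card (H `` {x}) \<le> ?D" for x
  proof (cases "x \<in> verts G")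
    case True
    have "H `` {x} = {e \<in> edges G. x \<in> e}" unfolding H_def by auto
    then show ?thesis using max_degree_ge[OF G True] by (simp add: degree_def)
  next
    case False
    then have "H `` {x} = {}" using edge unfolding H_def by blast
    then show ?thesis by simp
  qed
  have col: "card (H\<inverse> `` {e}) \<le> ?D" for e
  proof (cases "e \<in> edges G")
    case True
    then have "H\<inverse> `` {e} = e" unfolding H_def by auto
    then show ?thesis using edge(2)[OF True] ge by simp
  next
    case False
    then have "H\<inverse> `` {e} = {}" unfolding H_def by auto
    then show ?thesis by simp
  qed
  obtain c where c: "proper_rel_coloring H ?D c"
    using Konig_edge_coloring[OF finH row col] ..
  have lt: "\<And>x e. (x, e) \<in> H \<Longrightarrow> c x e < ?D"
    using c unfolding proper_rel_coloring_def by metis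
  have row_inj: "\<And>x e e'. (x, e) \<in> H \<Longrightarrow> (x, e') \<in> H \<Longrightarrow> c x e = c x e' \<Longrightarrow> e = e'"
    using c unfolding proper_rel_coloring_def by blast
  have col_inj: "\<And>x x' e. (x, e) \<in> H \<Longrightarrow> (x', e) \<in> H \<Longrightarrow> c x e = c x' e \<Longrightarrow> x = x'"
    using c unfolding proper_rel_coloring_def by blast
  \<comment> \<open>The two edges at \<open>Inr e\<close> take at most two of at least three
    colors.\<close>
  have "\<exists>i<?D. i \<notin> (\<lambda>x. c x e) ` e" if "e \<in> edges G" for e
  proof -
    have "card ((\<lambda>x. c x e) ` e) < ?D"
      using card_image_le[OF edge(3)[OF that], of "\<lambda>x. c x e"] edge(2)[OF that] ge by linarith
    then show ?thesis using free_color edge(3)[OF that] by (metis finite_imageI)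
  qed
  then obtain m where m: "\<And>e. e \<in> edges G \<Longrightarrow> m e < ?D \<and> m e \<notin> (\<lambda>x. c x e) ` e"
    by metis
  \<comment> \<open>On an edge \<open>{Inl x, Inr e}\<close> the two descriptions recover
    \<open>x\<close> and \<open>e\<close>, since each summand type contributes exactly one
    end.\<close>
  define f :: "('a + 'a set) + ('a + 'a set) set \<Rightarrow> nat" where
    "f = case_sum (case_sum (\<lambda>x. ?D) m)
       (\<lambda>h. c (THE x. Inl x \<in> h) (THE e. Inr e \<in> h))"
  have f_vert: "f (Inl (Inl x)) = ?D" for x
    by (simp add: f_def)
  have f_sub: "f (Inl (Inr e)) = m e" for e
    by (simp add: f_def)
  have f_edge: "f (Inr {Inl x, Inr e}) = c x e" for x e
    by (simp add: f_def)
  have f_edge': "f (Inr {Inr e, Inl x}) = c x e" for x e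
    using f_edge[of x e] by (simp add: insert_commute)
  have m_H: "m e < ?D" "m e \<noteq> c x e" if "(x, e) \<in> H" for x e
    using m that unfolding H_def by auto
  have proper: "proper_total_coloring ?S f"
    unfolding proper_total_coloring_def
  proof (intro conjI allI impI ballI)
    fix u v assume "{u, v} \<in> edges ?S"
    then show "f (Inl u) \<noteq> f (Inl v)"
      unfolding ES by (auto simp: doubleton_eq_iff f_vert f_sub dest!: m_H(1))
  next
    fix h h' assume h: "h \<in> edges ?S" "h' \<in> edges ?S" "h \<noteq> h' \<and> h \<inter> h' \<noteq> {}"
    then obtain x e x' e' where xe: "(x, e) \<in> H" "h = {Inl x, Inr e}"
      "(x', e') \<in> H" "h' = {Inl x', Inr e'}"
      unfolding ES by blast
    \<comment> \<open>Distinct edges that meet share exactly one end, which is either original or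
      new.\<close>
    with h(3) have "x = x' \<and> e \<noteq> e' \<or> x \<noteq> x' \<and> e = e'" by auto
    then show "f (Inr h) \<noteq> f (Inr h')"
      using xe row_inj col_inj by (auto simp: f_edge)
  next
    fix h v assume "h \<in> edges ?S" "v \<in> h"
    then show "f (Inl v) \<noteq> f (Inr h)"
      using lt m_H unfolding ES by (fastforce simp: f_vert f_sub f_edge)
  qed
  have in_set: "?D \<in> color_set ?S f (Inl x)" for x
    by (simp add: color_set_def f_vert)
  have notin_set: "?D \<notin> color_set ?S f (Inr e)" if "e \<in> edges G" for e
    using m[OF that] unfolding color_set_def ES
    by (auto simp: doubleton_eq_iff f_sub f_edge' dest: lt)
  have "avd_total_coloring ?S f"
    unfolding avd_total_coloring_def
  proof (intro conjI allI impI proper)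
    fix u v assume "{u, v} \<in> edges ?S"
    then consider x e where "e \<in> edges G" "u = Inl x" "v = Inr e"
      | x e where "e \<in> edges G" "u = Inr e" "v = Inl x"
      unfolding ES H_def by (auto simp: doubleton_eq_iff)
    then show "color_set ?S f u \<noteq> color_set ?S f v"
      using in_set notin_set by cases metis+
  qed
  moreover have "f ` (verts ?S <+> edges ?S) \<subseteq> {..?D}"
  proof -
    have "f (Inl v) \<le> ?D" if "v \<in> verts ?S" for v
      using that m unfolding subdivision_def by (auto simp: f_vert f_sub intro: less_imp_le)
    moreover have "f (Inr h) \<le> ?D" if "h \<in> edges ?S" for h
      using that lt unfolding ES by (auto simp: f_edge intro: less_imp_le)
    ultimately show ?thesis by auto
  qed
  ultimately show thesis by (rule that)
qed

theorem theorem2p6: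
  fixes G :: "'a ugraph"
  assumes "fin_simple_graph G"
    and "connected_graph G"
    and "max_degree G \<ge> 3"
  shows "avd_type (subdivision G) 1"
proof -
  let ?S = "subdivision G" and ?D = "max_degree G"
  \<comment> \<open>A vertex is needed for the maximum degree to be attained.\<close>
  have ne: "verts G \<noteq> {}" using assms(2) by (simp add: connected_graph_def)
  have S: "fin_simple_graph ?S" by (rule fin_simple_graph_subdivision[OF assms(1)])
  have D: "max_degree ?S = ?D"
    using max_degree_subdivision[OF assms(1) ne] assms(3) by simp
  have "verts ?S \<noteq> {}" using ne by (auto simp: subdivision_def)
  then obtain w where w: "w \<in> verts ?S" "degree ?S w = ?D"
    using max_degree_attained[OF S] D by metis
  have lower: "?D + 1 \<le> card (f ` (verts ?S <+> edges ?S))"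
    if "avd_total_coloring ?S f" for f :: "('a + 'a set) + ('a + 'a set) set \<Rightarrow> nat"
    using degree_less_card_colors[OF S _ w(1), of f] w(2) that
    by (simp add: avd_total_coloring_def)
  obtain f :: "('a + 'a set) + ('a + 'a set) set \<Rightarrow> nat" where f: "avd_total_coloring ?S f"
    and sub: "f ` (verts ?S <+> edges ?S) \<subseteq> {..?D}"
    using subdivision_coloring[OF assms(1,3)] .
  \<comment> \<open>The set \<open>{..?D}\<close> has \<open>?D + 1\<close> elements, so the lower
    bound forces every color to occur, as the exact count in the definition of the chromatic number
    requires.\<close>
  have "card (f ` (verts ?S <+> edges ?S)) = ?D + 1"
    using lower[OF f] card_mono[OF _ sub] by simp
  then have "avd_total_chromatic_number ?S = ?D + 1"
    unfolding avd_total_chromatic_number_def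
    using f lower by (intro Least_equality) auto
  then show ?thesis by (simp add: avd_type_def D)
qed

end
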